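(* Let $n\ge 1$ and let $\mathbf{A}\in\mathbb{C}^{n\times n}$ be skew-Hermitian, i.e. $\mathbf{A}=-\mathbf{A}^\dagger$. Then $\mathbf{A}$ has a nontrivial fremdervector if and only if $\mathbf{A}$ is indefinite, that is, $\mathbf{A}$ has at least one eigenvalue with positive imaginary part and at least one eigenvalue with negative imaginary part.
   Context: $\langle\cdot,\cdot\rangle$ is the usual inner product on $\mathbb{C}^n$ and $\mathbf{A}^\dagger$ is the conjugate transpose of $\mathbf{A}$. A vector $x\in\mathbb{C}^n$ is a fremdervector of $\mathbf{A}$ if $\langle x,\mathbf{A}x\rangle=0$. A vector $x\in\ker(\mathbf{A})\cup\ker(\mathbf{A}^\dagger)$ is called a trivial fremdervector of $\mathbf{A}$; a nontrivial fremdervector of $\mathbf{A}$ is a fremdervector $x$ with $x\notin\ker(\mathbf{A})\cup\ker(\mathbf{A}^\dagger)$. *)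

theory Defs
  imports
    "Jordan_Normal_Form.Schur_Decomposition"
    "Jordan_Normal_Form.Matrix_Kernel"
begin

definition skew_hermitian :: "complex mat \<Rightarrow> bool" where
  "skew_hermitian A \<longleftrightarrow> A = - mat_adjoint A"

text \<open>
  The scalar product \<open>x \<bullet>c y\<close> conjugates its second argument; swapping the arguments only
  conjugates the value, so the condition below does not depend on which argument of the
  inner product is taken to be the linear one.
\<close>

definition fremdervector :: "complex mat \<Rightarrow> complex vec \<Rightarrow> bool" where
  "fremdervector A x \<longleftrightarrow> x \<in> carrier_vec (dim_col A) \<and> x \<bullet>c (A *\<^sub>v x) = 0"

definition nontrivial_fremdervector :: "complex mat \<Rightarrow> complex vec \<Rightarrow> bool" where
  "nontrivial_fremdervector A x \<longleftrightarrow>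
     fremdervector A x \<and> x \<notin> mat_kernel A \<union> mat_kernel (mat_adjoint A)"

text \<open>
  Indefiniteness in the sense used for skew-Hermitian matrices, whose eigenvalues are
  purely imaginary.
\<close>

definition skew_indefinite :: "complex mat \<Rightarrow> bool" where
  "skew_indefinite A \<longleftrightarrow>
     (\<exists>k. eigenvalue A k \<and> Im k > 0) \<and> (\<exists>k. eigenvalue A k \<and> Im k < 0)"

end

theory Submission
  imports Defs
begin

text \<open>
  A skew-Hermitian matrix is unitarily diagonalizable with purely imaginary eigenvalues \<open>\<i> t\<^sub>j\<close>, so if
  \<open>x\<close> has coordinates \<open>c\<^sub>j\<close> in an orthonormal eigenbasis, then
  \<open>\<langle>A x, x\<rangle> = \<i> \<Sum>\<^sub>j t\<^sub>j \<bar>c\<^sub>j\<bar>\<^sup>2\<close>. If all \<open>t\<^sub>j\<close> have the same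
  weak sign, this sum vanishes only when every \<open>t\<^sub>j c\<^sub>j\<close> does, that is, when \<open>A x = 0\<close>
  (\<open>semidefinite_form_zero_imp_kernel\<close>); applied to both signs, this gives one direction. If two
  eigenvalues have opposite signs, suitably weighted eigenvectors for them balance to a fremdervector
  outside the kernel (\<open>nontrivial_fremdervector_of_indefinite\<close>). The kernels of \<open>A\<close> and of its
  adjoint \<open>- A\<close> coincide, so triviality just means \<open>A x = 0\<close>.

  Instead of a unitary matrix, the proof uses the pointwise form of the spectral theorem: every vector
  is a sum of pairwise orthogonal eigenvectors (\<open>skew_hermitian_orthogonal_eigensum\<close>). A product of
  factors \<open>A - e\<close> annihilates the whole space, by Schur triangularization. Up to a scalar,
  multiplication by all factors but the outermost projects orthogonally onto the eigenspace of the
  outermost root, and the remainder is annihilated by a shorter product.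
\<close>
section \<open>Skew-Hermitian matrices and the inner product\<close>

lemma skew_hermitian_index:
  assumes A: "A \<in> carrier_mat n n" and skew: "skew_hermitian A" and "i < n" "j < n"
  shows "A $$ (i, j) = - cnj (A $$ (j, i))"
proof -
  have "A $$ (i, j) = (- mat_adjoint A) $$ (i, j)"
    using skew unfolding skew_hermitian_def by simp
  also have "\<dots> = - cnj (A $$ (j, i))"
    using A assms(3,4) by (simp add: mat_adjoint_def mat_of_rows_def)
  finally show ?thesis .
qed

lemma skew_hermitian_cscalar_prod:
  assumes A: "A \<in> carrier_mat n n" and skew: "skew_hermitian A"
    and v: "v \<in> carrier_vec n" and w: "w \<in> carrier_vec n"
  shows "(A *\<^sub>v v) \<bullet>c w = - (v \<bullet>c (A *\<^sub>v w))"
proof -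
  have "(A *\<^sub>v v) \<bullet>c w = (\<Sum>i<n. \<Sum>j<n. A $$ (i, j) * v $ j * cnj (w $ i))"
    using A v w by (simp add: scalar_prod_def sum_distrib_right atLeast0LessThan)
  also have "\<dots> = (\<Sum>j<n. \<Sum>i<n. A $$ (i, j) * v $ j * cnj (w $ i))"
    by (rule sum.swap)
  also have "\<dots> = (\<Sum>j<n. \<Sum>i<n. - (v $ j * (cnj (A $$ (j, i)) * cnj (w $ i))))"
  proof (intro sum.cong refl)
    fix i j assume "i \<in> {..<n}" "j \<in> {..<n}"
    hence "A $$ (i, j) = - cnj (A $$ (j, i))"
      using skew_hermitian_index[OF A skew, of i j] by simp
    thus "A $$ (i, j) * v $ j * cnj (w $ i) = - (v $ j * (cnj (A $$ (j, i)) * cnj (w $ i)))"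
      by (simp only: mult_minus_left mult_minus_right mult_ac)
  qed
  also have "\<dots> = - (v \<bullet>c (A *\<^sub>v w))"
    using A v w by (simp add: scalar_prod_def sum_distrib_left sum_negf atLeast0LessThan)
  finally show ?thesis .
qed

lemma cscalar_prod_swap:
  fixes v w :: "complex vec"
  assumes "v \<in> carrier_vec n" "w \<in> carrier_vec n"
  shows "w \<bullet>c v = cnj (v \<bullet>c w)"
  using assms by (simp add: scalar_prod_def mult.commute)

lemma cscalar_prod_self_real:
  fixes v :: "complex vec"
  shows "v \<bullet>c v = of_real (Re (v \<bullet>c v))"
  using conjugate_square_ge_0_vec[of v] by (auto simp: less_eq_complex_def complex_eq_iff)

lemma cscalar_prod_self_pos:
  fixes v :: "complex vec"
  assumes "v \<in> carrier_vec n" "v \<noteq> 0\<^sub>v n"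
  shows "Re (v \<bullet>c v) > 0"
  using conjugate_square_greater_0_vec[OF assms(1)] assms(2) by (auto simp: less_complex_def)

lemma skew_hermitian_eigenvalue_imaginary:
  assumes A: "A \<in> carrier_mat n n" and skew: "skew_hermitian A"
    and u: "u \<in> carrier_vec n" "u \<noteq> 0\<^sub>v n" and Au: "A *\<^sub>v u = k \<cdot>\<^sub>v u"
  shows "cnj k = - k"
proof -
  have "k * (u \<bullet>c u) = - (cnj k * (u \<bullet>c u))"
    using skew_hermitian_cscalar_prod[OF A skew u(1) u(1)] u
    by (simp add: Au conjugate_smult_vec)
  moreover have "u \<bullet>c u \<noteq> 0" using u by simp
  ultimately have "k = - cnj k" by (metis minus_mult_left mult_right_cancel)
  thus ?thesis by (metis minus_minus)
qed

text \<open>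
  Moving \<open>A\<close> across the inner product turns \<open>k\<close> into \<open>- cnj k\<close>, which is \<open>k\<close> again since \<open>k\<close> is
  imaginary unless \<open>u = 0\<close>. Hence taking inner products with an eigenvector turns \<open>A\<close> into a scalar; with two
  eigenvectors, this is the orthogonality of different eigenspaces.
\<close>
lemma cscalar_prod_eigenvector_skew_image:
  assumes A: "A \<in> carrier_mat n n" and skew: "skew_hermitian A"
    and u: "u \<in> carrier_vec n" and Au: "A *\<^sub>v u = k \<cdot>\<^sub>v u" and w: "w \<in> carrier_vec n"
  shows "(A *\<^sub>v w) \<bullet>c u = k * (w \<bullet>c u)"
proof (cases "u = 0\<^sub>v n")
  case True
  thus ?thesis using A w by simp
next
  case False
  have "(A *\<^sub>v w) \<bullet>c u = - (cnj k * (w \<bullet>c u))"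
    using skew_hermitian_cscalar_prod[OF A skew w u] u w by (simp add: Au conjugate_smult_vec)
  thus ?thesis using skew_hermitian_eigenvalue_imaginary[OF A skew u False Au] by simp
qed

section \<open>Products of shifted matrices\<close>

text \<open>
  The factors are applied from the last root to the first, so that vanishing of the product for
  \<open>e # es\<close> says directly that the product for \<open>es\<close> lies in the eigenspace of \<open>e\<close>, without any
  commutation of factors.
\<close>
fun shift_prod :: "complex mat \<Rightarrow> complex list \<Rightarrow> complex vec \<Rightarrow> complex vec" where
  "shift_prod A [] x = x"
| "shift_prod A (e # es) x = A *\<^sub>v shift_prod A es x - e \<cdot>\<^sub>v shift_prod A es x"

lemma shift_prod_carrier [simp]:
  assumes "A \<in> carrier_mat n n" "x \<in> carrier_vec n"
  shows "shift_prod A es x \<in> carrier_vec n"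
  by (induction es) (use assms in auto)

lemma shift_prod_diff_smult:
  assumes A: "A \<in> carrier_mat n n" and x: "x \<in> carrier_vec n" and y: "y \<in> carrier_vec n"
  shows "shift_prod A es (x - c \<cdot>\<^sub>v y) = shift_prod A es x - c \<cdot>\<^sub>v shift_prod A es y"
proof (induction es)
  case (Cons e es)
  let ?u = "shift_prod A es x" and ?v = "shift_prod A es y"
  have uv: "?u \<in> carrier_vec n" "?v \<in> carrier_vec n" using assms by auto
  have "A *\<^sub>v (?u - c \<cdot>\<^sub>v ?v) = A *\<^sub>v ?u - c \<cdot>\<^sub>v (A *\<^sub>v ?v)"
    using A uv by (simp add: mult_minus_distrib_mat_vec[OF A] mult_mat_vec[OF A])
  with Cons show ?case using A uv
    by (intro eq_vecI) (auto simp: algebra_simps)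
qed simp

lemma shift_prod_eigenvector:
  assumes A: "A \<in> carrier_mat n n" and u: "u \<in> carrier_vec n" and Au: "A *\<^sub>v u = k \<cdot>\<^sub>v u"
  shows "shift_prod A es u = (\<Prod>e\<leftarrow>es. k - e) \<cdot>\<^sub>v u"
proof (induction es)
  case (Cons e es)
  thus ?case using A u
    by (simp add: mult_mat_vec[OF A u] Au) (intro eq_vecI, auto simp: algebra_simps)
qed simp

text \<open>
  The component of \<open>w\<close> along an eigenvector sees each factor \<open>A - e\<close> as the scalar \<open>k - e\<close>, even
  though \<open>w\<close> itself is arbitrary. This one identity yields both the orthogonality in the spectral
  decomposition and the fact that repeated roots can be dropped.
\<close>
lemma cscalar_prod_shift_prod_eigenvector:
  assumes A: "A \<in> carrier_mat n n" and skew: "skew_hermitian A"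
    and u: "u \<in> carrier_vec n" and Au: "A *\<^sub>v u = k \<cdot>\<^sub>v u" and w: "w \<in> carrier_vec n"
  shows "shift_prod A es w \<bullet>c u = (\<Prod>e\<leftarrow>es. k - e) * (w \<bullet>c u)"
proof (induction es)
  case (Cons e es)
  let ?v = "shift_prod A es w"
  have v: "?v \<in> carrier_vec n" using A w by simp
  have "(A *\<^sub>v ?v - e \<cdot>\<^sub>v ?v) \<bullet>c u = (A *\<^sub>v ?v) \<bullet>c u - e * (?v \<bullet>c u)"
    using A u v by (subst minus_scalar_prod_distrib[of _ n]) auto
  also have "\<dots> = (k - e) * (?v \<bullet>c u)"
    by (simp add: cscalar_prod_eigenvector_skew_image[OF A skew u Au v] algebra_simps)
  finally show ?case using Cons by simp
qed simp

text \<open>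
  For upper triangular \<open>B\<close>, the factor for the diagonal entry at position \<open>m\<close> maps the span of
  the first \<open>m + 1\<close> unit vectors into the span of the first \<open>m\<close>. Applying the diagonal entries from the last to the
  first therefore shrinks the support step by step, down to nothing at \<open>j = 0\<close>.
\<close>
lemma shift_prod_upper_triangular:
  assumes B: "B \<in> carrier_mat n n" and tri: "upper_triangular B" and v: "v \<in> carrier_vec n"
    and "j \<le> n" "j \<le> i" "i < n"
  shows "shift_prod B (drop j (diag_mat B)) v $ i = 0"
  using assms(4-)
proof (induction arbitrary: i rule: inc_induct)
  case base
  thus ?case by simp
next
  case (step m)
  let ?w = "shift_prod B (drop (Suc m) (diag_mat B)) v"
  have w: "?w \<in> carrier_vec n" using B v by simp
  have len: "length (diag_mat B) = n" using B by (simp add: diag_mat_def)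
  have drop: "drop m (diag_mat B) = B $$ (m, m) # drop (Suc m) (diag_mat B)"
    using step(2) len B by (subst Cons_nth_drop_Suc[symmetric]) (auto simp: diag_mat_def)
  have "row B i \<bullet> ?w = (\<Sum>l<n. B $$ (i, l) * ?w $ l)"
    using B w step by (simp add: scalar_prod_def atLeast0LessThan)
  \<comment> \<open>Triangularity kills the terms left of the diagonal, the induction hypothesis those
    from position \<open>m + 1\<close> on, so at most the diagonal term of row \<open>m\<close> survives.\<close>
  also have "\<dots> = (\<Sum>l<n. if l = i then B $$ (m, m) * ?w $ i else 0)"
  proof (intro sum.cong refl)
    fix l assume "l \<in> {..<n}"
    then have l: "l < n" by simp
    consider "l < i" | "l = i" "i = m" | "l \<ge> i" "l > m" using step(4) by linarith
    thus "B $$ (i, l) * ?w $ l = (if l = i then B $$ (m, m) * ?w $ i else 0)"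
    proof cases
      case 1
      thus ?thesis using upper_triangularD[OF tri, of l i] B step(5) by simp
    next
      case 3
      hence "?w $ l = 0" using step.IH[of l] l by simp
      thus ?thesis by (cases "l = i") auto
    qed simp
  qed
  also have "\<dots> = B $$ (m, m) * ?w $ i"
    using step(5) by simp
  finally have "row B i \<bullet> ?w = B $$ (m, m) * ?w $ i" .
  thus ?case using step(5) B w by (simp add: drop)
qed

lemma shift_prod_similar:
  assumes A: "A \<in> carrier_mat n n" and sim: "similar_mat_wit A B P Q" and x: "x \<in> carrier_vec n"
  shows "shift_prod A es x = P *\<^sub>v shift_prod B es (Q *\<^sub>v x)"
proof -
  note w = similar_mat_witD2[OF A sim]
  have "A * P = P * B * (Q * P)"
    unfolding w(3) using w(5-7) by (simp add: assoc_mult_mat[of _ n n _ n _ n])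
  hence AP: "A * P = P * B" using w(2,5,6) by simp
  show ?thesis
  proof (induction es)
    case Nil
    have "P *\<^sub>v (Q *\<^sub>v x) = (P * Q) *\<^sub>v x"
      by (rule assoc_mult_mat_vec[OF w(6,7) x, symmetric])
    thus ?case using w(1) x by simp
  next
    case (Cons e es)
    let ?v = "shift_prod B es (Q *\<^sub>v x)"
    have v: "?v \<in> carrier_vec n" using w x by simp
    have "A *\<^sub>v (P *\<^sub>v ?v) = (A * P) *\<^sub>v ?v"
      by (rule assoc_mult_mat_vec[OF A w(6) v, symmetric])
    also have "\<dots> = P *\<^sub>v (B *\<^sub>v ?v)"
      unfolding AP by (rule assoc_mult_mat_vec[OF w(6,5) v])
    finally have "A *\<^sub>v (P *\<^sub>v ?v) = P *\<^sub>v (B *\<^sub>v ?v)" .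
    thus ?case using w(5,6) v A Cons
      by (simp add: mult_minus_distrib_mat_vec[of _ n n] mult_mat_vec[of _ n n])
  qed
qed

text \<open>
  The part of the Cayley-Hamilton theorem that the spectral decomposition needs: triangularize, and
  let the diagonal supply the roots.
\<close>
lemma ex_annihilating_shift_prod:
  assumes A: "A \<in> carrier_mat n n"
  shows "\<exists>es. \<forall>x \<in> carrier_vec n. shift_prod A es x = 0\<^sub>v n"
proof -
  obtain as where as: "char_poly A = (\<Prod>a\<leftarrow>as. [:- a, 1:])"
    using char_poly_factorized[OF A] by blast
  obtain B P Q where "schur_decomposition A as = (B, P, Q)"
    by (metis prod_cases3)
  from schur_decomposition[OF A as this]
  have sim: "similar_mat_wit A B P Q" and tri: "upper_triangular B" by auto
  note w = similar_mat_witD2[OF A sim]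
  have "shift_prod A (diag_mat B) x = 0\<^sub>v n" if x: "x \<in> carrier_vec n" for x
  proof -
    have Qx: "Q *\<^sub>v x \<in> carrier_vec n" using w x by simp
    have "shift_prod B (diag_mat B) (Q *\<^sub>v x) \<in> carrier_vec n"
      using shift_prod_carrier[OF w(5) Qx] .
    hence "shift_prod B (diag_mat B) (Q *\<^sub>v x) = 0\<^sub>v n"
      using shift_prod_upper_triangular[OF w(5) tri Qx, of 0]
      by (intro eq_vecI) auto
    thus ?thesis using w(6) unfolding shift_prod_similar[OF A sim x] by auto
  qed
  thus ?thesis by blast
qed

section \<open>Orthogonal decomposition into eigenvectors\<close>

text \<open>
  A finite orthogonal eigenvector decomposition as a predicate on its sum: each new eigenvector need
  only be orthogonal to the partial sum so far, so that statements about quadratic forms follow by rule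
  induction without indexed sums of vectors. Zero summands are allowed, hence \<open>k\<close> need not be an
  eigenvalue.
\<close>
inductive orthogonal_eigensum :: "complex mat \<Rightarrow> nat \<Rightarrow> complex vec \<Rightarrow> bool"
  for A :: "complex mat" and n :: nat where
  zero: "orthogonal_eigensum A n (0\<^sub>v n)"
| add: "orthogonal_eigensum A n (y + u)"
  if "orthogonal_eigensum A n y" "y \<in> carrier_vec n" "u \<in> carrier_vec n" "A *\<^sub>v u = k \<cdot>\<^sub>v u" "y \<bullet>c u = 0"

text \<open>
  Put \<open>p(t) = \<Prod>\<^sub>k (t - k)\<close>, over the roots \<open>k\<close> in \<open>es\<close>; the vector
  \<open>u = p(A) x\<close> lies in the eigenspace of \<open>e\<close>. If
  \<open>p(e) \<noteq> 0\<close>, then \<open>u / p(e)\<close> is the orthogonal projection of \<open>x\<close> to that eigenspace and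
  \<open>p(A)\<close> kills the rest. If \<open>p(e) = 0\<close>, then \<open>e\<close> is a repeated root and
  \<open>\<langle>u, u\<rangle> = p(e) \<langle>x, u\<rangle> = 0\<close> shows that \<open>p(A)\<close> already kills \<open>x\<close>.
\<close>
lemma orthogonal_eigensum_if_annihilated:
  assumes A: "A \<in> carrier_mat n n" and skew: "skew_hermitian A"
    and "x \<in> carrier_vec n" and "shift_prod A es x = 0\<^sub>v n"
  shows "orthogonal_eigensum A n x"
  using assms(3,4)
proof (induction es arbitrary: x)
  case Nil
  thus ?case by (simp add: zero)
next
  case (Cons e es)
  define p where "p = (\<Prod>k\<leftarrow>es. e - k)"
  define u where "u = shift_prod A es x"
  have u: "u \<in> carrier_vec n" using A Cons.prems by (simp add: u_def)
  have Au: "A *\<^sub>v u = e \<cdot>\<^sub>v u"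
  proof (rule eq_vecI)
    fix i assume "i < dim_vec (e \<cdot>\<^sub>v u)"
    hence i: "i < n" using u by simp
    have "(A *\<^sub>v u - e \<cdot>\<^sub>v u) $ i = 0" using Cons.prems i by (simp add: u_def)
    thus "(A *\<^sub>v u) $ i = (e \<cdot>\<^sub>v u) $ i" using i A u by simp
  qed (use A u in simp)
  show ?case
  proof (cases "p = 0")
    case True
    have "u \<bullet>c u = p * (x \<bullet>c u)"
      using cscalar_prod_shift_prod_eigenvector[OF A skew u Au Cons.prems(1), of es]
      by (simp add: u_def p_def)
    hence "u = 0\<^sub>v n" using True u by simp
    thus ?thesis using Cons unfolding u_def by blast
  next
    case False
    define y where "y = x - (1 / p) \<cdot>\<^sub>v u"
    have y: "y \<in> carrier_vec n" using Cons.prems u by (simp add: y_def)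
    have "shift_prod A es y = u - (1 / p) \<cdot>\<^sub>v (p \<cdot>\<^sub>v u)"
      using shift_prod_diff_smult[OF A Cons.prems(1) u] shift_prod_eigenvector[OF A u Au]
      by (simp add: y_def p_def flip: u_def)
    also have "\<dots> = 0\<^sub>v n" using False u by (simp add: smult_smult_assoc)
    finally have y0: "shift_prod A es y = 0\<^sub>v n" .
    have "p * (y \<bullet>c u) = 0"
      using cscalar_prod_shift_prod_eigenvector[OF A skew u Au y, of es] y0 u
      by (simp add: p_def)
    hence "y \<bullet>c u = 0" using False by simp
    hence "orthogonal_eigensum A n (y + (1 / p) \<cdot>\<^sub>v u)"
      using u y Cons.IH[OF y y0]
      by (intro orthogonal_eigensum.add[where k = e])
         (auto simp: mult_mat_vec[OF A u] Au smult_smult_assoc conjugate_smult_vec mult.commute)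
    moreover have "y + (1 / p) \<cdot>\<^sub>v u = x"
      using Cons.prems u by (intro eq_vecI) (auto simp: y_def)
    ultimately show ?thesis by simp
  qed
qed

lemma skew_hermitian_orthogonal_eigensum:
  assumes A: "A \<in> carrier_mat n n" and "skew_hermitian A" "x \<in> carrier_vec n"
  shows "orthogonal_eigensum A n x"
proof -
  obtain es where "\<forall>x \<in> carrier_vec n. shift_prod A es x = 0\<^sub>v n"
    using ex_annihilating_shift_prod[OF A] by blast
  with assms(3) show ?thesis
    by (intro orthogonal_eigensum_if_annihilated[OF assms, of es]) simp
qed

section \<open>Semidefinite matrices have only trivial fremdervectors\<close>

text \<open>
  The form is additive over an orthogonal eigenvector decomposition because the mixed terms vanish, and
  each eigenvector contributes \<open>Im k\<close> times its squared norm. All contributions have the sign of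
  \<open>s\<close>, so a vanishing total forces every one of them to vanish. The factor \<open>s\<close> treats positive and
  negative semidefiniteness at once.
\<close>
lemma semidefinite_form_zero_imp_kernel:
  assumes A: "A \<in> carrier_mat n n" and skew: "skew_hermitian A"
    and sign: "\<And>k. eigenvalue A k \<Longrightarrow> s * Im k \<ge> 0" and s: "s \<noteq> (0 :: real)"
    and x: "orthogonal_eigensum A n x"
  shows "s * Im ((A *\<^sub>v x) \<bullet>c x) \<ge> 0 \<and> (Im ((A *\<^sub>v x) \<bullet>c x) = 0 \<longrightarrow> A *\<^sub>v x = 0\<^sub>v n)"
  using x
proof induction
  case zero
  have "A *\<^sub>v 0\<^sub>v n = 0\<^sub>v n" using A by (intro eq_vecI) auto
  thus ?case by simp
next
  case (add y u k)
  note u = add.hyps(3) and y = add.hyps(2) and Au = add.hyps(4) and orth = add.hyps(5)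
  have Ay: "A *\<^sub>v y \<in> carrier_vec n" and Au': "A *\<^sub>v u \<in> carrier_vec n" using A u y by auto
  have "(A *\<^sub>v y) \<bullet>c u = 0"
    using cscalar_prod_eigenvector_skew_image[OF A skew u Au y] orth by simp
  moreover have "(A *\<^sub>v u) \<bullet>c y = 0"
    using cscalar_prod_swap[OF y u] orth u y by (simp add: Au)
  ultimately have "(A *\<^sub>v (y + u)) \<bullet>c (y + u) = (A *\<^sub>v y) \<bullet>c y + k * (u \<bullet>c u)"
    using u y Ay Au'
    by (simp add: mult_add_distrib_mat_vec[OF A] conjugate_add_vec[of _ n]
        add_scalar_prod_distrib[of _ n] scalar_prod_add_distrib[of _ n]) (simp add: Au)
  hence split: "Im ((A *\<^sub>v (y + u)) \<bullet>c (y + u)) = Im ((A *\<^sub>v y) \<bullet>c y) + Im k * Re (u \<bullet>c u)"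
    using arg_cong[OF cscalar_prod_self_real[of u], of Im] by simp
  show ?case
  proof (cases "u = 0\<^sub>v n")
    case True
    hence "y + u = y" using y by simp
    thus ?thesis using add.IH by simp
  next
    case False
    have "eigenvalue A k"
      using u False Au A unfolding eigenvalue_def eigenvector_def by auto
    hence "s * Im k \<ge> 0" by (rule sign)
    have pos: "Re (u \<bullet>c u) > 0" using u False by (rule cscalar_prod_self_pos)
    have summand: "s * (Im k * Re (u \<bullet>c u)) \<ge> 0"
      using mult_nonneg_nonneg[OF \<open>s * Im k \<ge> 0\<close> less_imp_le[OF pos]] by (simp add: mult.assoc)
    have "A *\<^sub>v (y + u) = 0\<^sub>v n" if "Im ((A *\<^sub>v (y + u)) \<bullet>c (y + u)) = 0"
    proof -
      have "s * Im ((A *\<^sub>v y) \<bullet>c y) + s * (Im k * Re (u \<bullet>c u)) = 0"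
        using that split by (simp flip: distrib_left)
      with summand add.IH have "s * Im ((A *\<^sub>v y) \<bullet>c y) = 0" "s * (Im k * Re (u \<bullet>c u)) = 0"
        by linarith+
      with s pos have "Im k = 0" "Im ((A *\<^sub>v y) \<bullet>c y) = 0" by auto
      moreover have "Re k = 0"
        using skew_hermitian_eigenvalue_imaginary[OF A skew u False Au] by (simp add: complex_eq_iff)
      ultimately have "k = 0" "A *\<^sub>v y = 0\<^sub>v n"
        using add.IH by (simp_all add: complex_eq_iff)
      moreover have "0 \<cdot>\<^sub>v u = 0\<^sub>v n" using u by (intro eq_vecI) auto
      ultimately show ?thesis using u y Au by (simp add: mult_add_distrib_mat_vec[OF A])
    qed
    thus ?thesis using add.IH summand split by (simp add: distrib_left)
  qed
qed

lemma mat_kernel_adjoint_skew_hermitian: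
  assumes "skew_hermitian A" "A \<in> carrier_mat n n"
  shows "mat_kernel (mat_adjoint A) = mat_kernel A"
proof -
  have "mat_adjoint A = - A"
    using assms(1) unfolding skew_hermitian_def by (metis uminus_uminus_mat)
  thus ?thesis using assms(2) by (auto simp: mat_kernel_def uminus_zero_vec_eq[of _ n])
qed

section \<open>Eigenvalues of opposite sign balance\<close>

lemma nontrivial_fremdervector_of_indefinite:
  assumes A: "A \<in> carrier_mat n n" and skew: "skew_hermitian A" and indef: "skew_indefinite A"
  shows "\<exists>x. nontrivial_fremdervector A x"
proof -
  obtain k l where k: "eigenvalue A k" "Im k > 0" and l: "eigenvalue A l" "Im l < 0"
    using indef unfolding skew_indefinite_def by blast
  obtain u v where u: "u \<in> carrier_vec n" "u \<noteq> 0\<^sub>v n" and Au: "A *\<^sub>v u = k \<cdot>\<^sub>v u"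
    and v: "v \<in> carrier_vec n" "v \<noteq> 0\<^sub>v n" and Av: "A *\<^sub>v v = l \<cdot>\<^sub>v v"
    using k(1) l(1) A unfolding eigenvalue_def eigenvector_def by auto
  have "cnj k = - k" "cnj l = - l"
    using skew_hermitian_eigenvalue_imaginary[OF A skew] u v Au Av by blast+
  hence kl: "k = Complex 0 (Im k)" "l = Complex 0 (Im l)" by (auto simp: complex_eq_iff)
  have "l * (v \<bullet>c u) = k * (v \<bullet>c u)"
    using cscalar_prod_eigenvector_skew_image[OF A skew u(1) Au v(1)] u v by (simp add: Av)
  hence vu: "v \<bullet>c u = 0" using k l by auto
  have uv: "u \<bullet>c v = 0" using cscalar_prod_swap[OF v(1) u(1)] vu by simp
  define a b where "a = Re (u \<bullet>c u)" and "b = Re (v \<bullet>c v)"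
  have a: "u \<bullet>c u = of_real a" "a > 0" and b: "v \<bullet>c v = of_real b" "b > 0"
    unfolding a_def b_def
    by (rule cscalar_prod_self_real cscalar_prod_self_pos[OF u] cscalar_prod_self_pos[OF v])+
  \<comment> \<open>The form is \<open>c\<^sup>2 a cnj k + d\<^sup>2 b cnj l\<close>; these weights make the two terms cancel.\<close>
  define c d where "c = sqrt (- Im l * b)" and "d = sqrt (Im k * a)"
  have c: "c\<^sup>2 = - Im l * b" "c > 0" and d: "d\<^sup>2 = Im k * a"
    using a b k l by (auto simp: c_def d_def mult_neg_pos mult_nonpos_nonneg)
  define x where "x = of_real c \<cdot>\<^sub>v u + of_real d \<cdot>\<^sub>v v"
  have x: "x \<in> carrier_vec n" using u v by (simp add: x_def)
  have Ax: "A *\<^sub>v x = (of_real c * k) \<cdot>\<^sub>v u + (of_real d * l) \<cdot>\<^sub>v v"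
    using u v by (simp add: x_def mult_add_distrib_mat_vec[OF A] mult_mat_vec[OF A]
        Au Av smult_smult_assoc)
  have "x \<bullet>c (A *\<^sub>v x) = cnj k * (of_real (c\<^sup>2) * of_real a) + cnj l * (of_real (d\<^sup>2) * of_real b)"
    unfolding Ax unfolding x_def using u v
    by (simp add: conjugate_add_vec[of _ n] conjugate_smult_vec add_scalar_prod_distrib[of _ n]
        scalar_prod_add_distrib[of _ n] uv vu a b power2_eq_square)
  also have "\<dots> = 0"
    unfolding c d by (subst kl(1), subst (2) kl(2)) (simp add: complex_eq_iff)
  finally have fremder: "x \<bullet>c (A *\<^sub>v x) = 0" .
  \<comment> \<open>The image of \<open>x\<close> is nonzero because its component along \<open>u\<close> is.\<close>
  have "(A *\<^sub>v x) \<bullet>c u = of_real c * k * of_real a"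
    unfolding Ax using u v by (simp add: add_scalar_prod_distrib[of _ n] vu a)
  hence "(A *\<^sub>v x) \<bullet>c u \<noteq> 0" using c a k by auto
  hence "A *\<^sub>v x \<noteq> 0\<^sub>v n" using u by auto
  hence "x \<notin> mat_kernel A" using A by (simp add: mat_kernel_def)
  thus ?thesis
    using fremder x A mat_kernel_adjoint_skew_hermitian[OF skew A]
    by (auto simp: nontrivial_fremdervector_def fremdervector_def)
qed

theorem corollary4p4:
  fixes A :: "complex mat" and n :: nat
  assumes "n \<ge> 1"
    and "A \<in> carrier_mat n n"
    and "skew_hermitian A"
  shows "(\<exists>x. nontrivial_fremdervector A x) \<longleftrightarrow> skew_indefinite A"
proof
  note A = assms(2) and skew = assms(3)
  assume "\<exists>x. nontrivial_fremdervector A x"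
  then obtain x where x: "x \<in> carrier_vec n" and zero: "x \<bullet>c (A *\<^sub>v x) = 0"
    and ker: "x \<notin> mat_kernel A"
    using A by (auto simp: nontrivial_fremdervector_def fremdervector_def)
  have Ax: "A *\<^sub>v x \<noteq> 0\<^sub>v n" using ker A x by (simp add: mat_kernel_def)
  have zero': "(A *\<^sub>v x) \<bullet>c x = 0"
    using skew_hermitian_cscalar_prod[OF A skew x x] zero by simp
  have signs: "\<exists>k. eigenvalue A k \<and> s * Im k < 0" if "s \<noteq> 0" for s :: real
  proof (rule ccontr)
    assume "\<not> ?thesis"
    hence "s * Im k \<ge> 0" if "eigenvalue A k" for k using that by force
    with semidefinite_form_zero_imp_kernel[OF A skew _ that
        skew_hermitian_orthogonal_eigensum[OF A skew x]]
    have "A *\<^sub>v x = 0\<^sub>v n" using zero' by simp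
    thus False using Ax by simp
  qed
  show "skew_indefinite A"
    unfolding skew_indefinite_def using signs[of 1] signs[of "-1"] by simp
next
  assume "skew_indefinite A"
  thus "\<exists>x. nontrivial_fremdervector A x"
    by (rule nontrivial_fremdervector_of_indefinite[OF assms(2,3)])
qed

end
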